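(* Fix a target evolution time $T>0$ and an error tolerance $\epsilon>0$. Let $\Lambda:[0,\infty)\to[0,\infty)$ be one of the three functions $\Lambda(t)=e^{-\lambda t}$, $\Lambda(t)=1$, $\Lambda(t)=e^{\lambda t}$, where $\lambda>0$ in the exponential cases, let $C_{\rm step}>0$, and set, correspondingly, $$M=\begin{cases}\left\lceil\max\left\{1,\,T,\,\lambda T,\,\dfrac{2C_{\rm step}T}{\lambda\epsilon}\right\}\right\rceil & (\Lambda(t)=e^{-\lambda t}),\\[2mm] \left\lceil\max\left\{1,\,T,\,\dfrac{C_{\rm step}T^2}{\epsilon}\right\}\right\rceil & (\Lambda(t)=1),\\[2mm] \left\lceil\max\left\{1,\,T,\,\lambda T,\,\dfrac{C_{\rm step}Te^{\lambda T}}{\lambda\epsilon}\right\}\right\rceil & (\Lambda(t)=e^{\lambda t}),\end{cases}\qquad \tau=\frac{T}{M}.$$ Let the implemented one-step map be $\widetilde\Phi_h(\rho)=V(\rho,h)\rho V(\rho,h)^\dagger$ for $\rho\in\mathcal S_{\rm pure}$, $0<h\le 1$, where $V(\rho,h)$ is unitary. Let $U_0$ be a unitary (the initial state preparation oracle) with $U_0|0\rangle=|\psi(0)\rangle$, put $\rho_0=|\psi(0)\rangle\langle\psi(0)|\in\mathcal S_{\rm pure}$, $\rho(t)=\varphi_t(\rho_0)$, and for $k\in\{0,1,\dots,M-1\}$ define $$\rho_{k+1}=\widetilde\Phi_\tau(\rho_k),\qquad U_{k+1}=V(\rho_k,\tau)U_k .$$ Suppose that $\Omega\subset\mathcal S_{\rm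 pure}$ satisfies: (i) $\{\rho(t)\mid t\in[0,T]\}\cup\{\rho_k\mid k\in\{0,1,\dots,M\}\}\subset\Omega$; (ii) $\|\varphi_t(\sigma_1)-\varphi_t(\sigma_2)\|_1\le\Lambda(t)\|\sigma_1-\sigma_2\|_1$ for all $\sigma_1,\sigma_2\in\Omega$ and $t\ge0$; (iii) $\|\widetilde\Phi_h(\sigma)-\varphi_h(\sigma)\|_1\le C_{\rm step}h^2$ for every $\sigma\in\Omega$ and $0<h\le1$, with $C_{\rm step}$ independent of $h$ and $\sigma$. Suppose also that each $V(\rho_k,\tau)$ admits an ancilla-free implementation using at most $b$ calls in total to $U_k$ and $U_k^\dagger$, uniformly in $k$ ($b$ may depend on the chosen step size and accuracy). Then $U_M$ prepares $|\psi_M\rangle=U_M|0\rangle$ with $\rho_M=|\psi_M\rangle\langle\psi_M|$ satisfying $\|\rho_M-\rho(T)\|_1\le\epsilon$, and the total number $Q_M$ of queries to $U_0$ and $U_0^\dagger$ used to implement $U_M$ satisfies $$Q_M\le(1+b)^M=\exp\left(M\log(1+b)\right).$$ In particular, one may take $b=8+4a_G$ for the general implementation $V=V_{\rm Gen}$, where $a_G$ is a uniform (in $k$ and in the sign) upper bound on the total number of calls to $U_k$ and $U_k^\dagger$ required to implement $A_G(\rho_k,\pm\sqrt{\tau/2})$; and one may take $b=4+2a_H$ for the NLSE-specific implementation $V=V_{\rm NLSE}$, where $a_H$ is a uniform (in $k$ and in the sign) upper bound on the total number of calls to $U_k$ and $U_k^\dagger$ required to implement $A_H(\rho_k,\pm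\tau/2)$.
   Context: $\mathcal H$ is a finite-dimensional complex Hilbert space with a fixed unit reference vector $|0\rangle$ (the tensor-product zero state), and $\mathcal S_{\rm pure}=\{|\psi\rangle\langle\psi| : |\psi\rangle\in\mathcal H,\ \langle\psi|\psi\rangle=1\}$. $\|\cdot\|_{\rm op}$ is the operator norm and $\|X\|_1=\operatorname{Tr}\sqrt{X^\dagger X}$ the trace norm. $G$ assigns to each $\rho\in\mathcal S_{\rm pure}$ a Hermitian operator $G(\rho)$ on $\mathcal H$, with finite constants $M_G,L_G\ge0$ such that $\|G(\rho)\|_{\rm op}\le M_G$ and $\|G(\rho)-G(\sigma)\|_{\rm op}\le L_G\|\rho-\sigma\|_1$ for all $\rho,\sigma\in\mathcal S_{\rm pure}$. For $\rho\in\mathcal S_{\rm pure}$ and $t\ge 0$, $\varphi_t(\rho)\in\mathcal S_{\rm pure}$ denotes the solution at time $t$ of $\frac{d}{dt}\rho(t)=[[\rho(t),G(\rho(t))],\rho(t)]$ with $\rho(0)=\rho$ (the evolution preserves $\mathcal S_{\rm pure}$). Circuit model: an ancilla-free implementation of a unitary on $\mathcal H$ using $q$ calls to $U$ and $U^\dagger$ is a factorization of it (up to global phase) into a product of unitaries on $\mathcal H$ in which $q$ factors are $U$ or $U^\dagger$ and the others are non-query gates (gates making no use of $U$). $Q_k$ is the number of calls to $U_0$ and $U_0^\dagger$ in the implementation of $U_k$ obtained by recursively expanding $U_{j+1}=V(\rho_j,\tau)U_j$, with $Q_0=1$; implementing $U_k^\dagger$ costs the same number of calls as $U_k$. For any real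 $\theta$, $e^{i\theta|0\rangle\langle0|}$ is a non-query gate, and for $\rho_k=U_k|0\rangle\langle0|U_k^\dagger$ one has $e^{i\theta\rho_k}=U_ke^{i\theta|0\rangle\langle0|}U_k^\dagger$. General implementation: with $s=\sqrt{\tau/2}$, $V_{\rm Gen}(\rho,\tau)=A_G(\rho,s)e^{i\rho s}A_G(\rho,-s)e^{-i\rho s}A_G(\rho,-s)e^{-i\rho s}A_G(\rho,s)e^{i\rho s}$, where $A_G(\rho,\theta)$ is an ancilla-free unitary, implemented with calls to a state preparation circuit for $\rho$ and its inverse, with $\|A_G(\rho,\pm s)-e^{\pm iG(\rho)s}\|_{\rm op}\le c_G\tau^2$ for all $0<\tau\le 1$, $c_G>0$ independent of $\rho,\tau$. NLSE-specific implementation: here $G(\rho)=-i[\rho,H(\rho)]$ with $H(\rho)$ Hermitian, $\|H(\rho)\|_{\rm op}\le M_H$ and $\|H(\rho)-H(\sigma)\|_{\rm op}\le L_H\|\rho-\sigma\|_1$ for all $\rho,\sigma\in\mathcal S_{\rm pure}$ (finite $M_H,L_H\ge 0$); $R_\rho=\mathbb I-2\rho$; $V_{\rm NLSE}(\rho,\tau)=A_H(\rho,-\tau/2)R_\rho A_H(\rho,\tau/2)R_\rho$, where $A_H(\rho,\theta)$ is an ancilla-free unitary, implemented with calls to a state preparation circuit for $\rho$ and its inverse, with $\|A_H(\rho,\theta)-e^{iH(\rho)\theta}\|_{\rm op}\le c_H\theta^2$ for all $0<|\theta|\le1$, $c_H>0$ independent of $\rho,\theta$. *)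

theory Defs
  imports "HOL-Analysis.Analysis"
begin

text \<open>
  A finite-dimensional complex Hilbert space is rendered as \<open>complex ^ 'n\<close>, whose library norm is
  the Hilbert space norm; operators are matrices with product \<open>**\<close> (the type class
  product \<open>*\<close> on this type is not the matrix product).
\<close>

type_synonym 'n cmat = "complex ^ 'n ^ 'n"

definition dagger :: "'n::finite cmat \<Rightarrow> 'n cmat" where
  "dagger A = (\<chi> i j. cnj (A $ j $ i))"

definition cscale :: "complex \<Rightarrow> 'n::finite cmat \<Rightarrow> 'n cmat" where
  "cscale c A = (\<chi> i j. c * A $ i $ j)"

definition hermitian :: "'n::finite cmat \<Rightarrow> bool" where
  "hermitian A \<longleftrightarrow> dagger A = A"

definition unitary :: "'n::finite cmat \<Rightarrow> bool" where
  "unitary A \<longleftrightarrow> dagger A ** A = mat 1 \<and> A ** dagger A = mat 1"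

definition commutator :: "'n::finite cmat \<Rightarrow> 'n cmat \<Rightarrow> 'n cmat" where
  "commutator A B = A ** B - B ** A"

definition cinner :: "complex ^ 'n::finite \<Rightarrow> complex ^ 'n \<Rightarrow> complex" where
  "cinner x y = (\<Sum>i\<in>UNIV. cnj (x $ i) * y $ i)"

definition psd :: "'n::finite cmat \<Rightarrow> bool" where
  "psd A \<longleftrightarrow> hermitian A \<and> (\<forall>x. 0 \<le> Re (cinner x (A *v x)))"

definition psd_sqrt :: "'n::finite cmat \<Rightarrow> 'n cmat" where
  "psd_sqrt A = (THE B. psd B \<and> B ** B = A)"

definition trace_norm :: "'n::finite cmat \<Rightarrow> real" where
  "trace_norm X = Re (trace (psd_sqrt (dagger X ** X)))"

definition op_norm :: "'n::finite cmat \<Rightarrow> real" where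
  "op_norm A = onorm ((*v) A)"

definition mat_exp :: "'n::finite cmat \<Rightarrow> 'n cmat" where
  "mat_exp A = (\<Sum>k. (1 / fact k) *\<^sub>R (((**) A) ^^ k) (mat 1))"

definition ketbra :: "complex ^ 'n::finite \<Rightarrow> 'n cmat" where
  "ketbra \<psi> = (\<chi> i j. \<psi> $ i * cnj (\<psi> $ j))"

definition pure_states :: "'n::finite cmat set" where
  "pure_states = {ketbra \<psi> | \<psi>. cinner \<psi> \<psi> = 1}"

text \<open>\<open>\<phi> t \<rho>\<close> is the value at time \<open>t\<close> of the solution started in \<open>\<rho>\<close>; at \<open>t = 0\<close> the
  derivative is one-sided.\<close>

definition double_bracket_flow ::
    "('n::finite cmat \<Rightarrow> 'n cmat) \<Rightarrow> (real \<Rightarrow> 'n cmat \<Rightarrow> 'n cmat) \<Rightarrow> bool" where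
  "double_bracket_flow G \<phi> \<longleftrightarrow>
     (\<forall>\<rho>\<in>pure_states. \<phi> 0 \<rho> = \<rho> \<and>
       (\<forall>t\<ge>0. \<phi> t \<rho> \<in> pure_states \<and>
         ((\<lambda>r. \<phi> r \<rho>) has_vector_derivative
            commutator (commutator (\<phi> t \<rho>) (G (\<phi> t \<rho>))) (\<phi> t \<rho>)) (at t within {0..})))"

definition bounded_lipschitz_generator ::
    "('n::finite cmat \<Rightarrow> 'n cmat) \<Rightarrow> real \<Rightarrow> real \<Rightarrow> bool" where
  "bounded_lipschitz_generator G B L \<longleftrightarrow> 0 \<le> B \<and> 0 \<le> L \<and>
     (\<forall>\<rho>\<in>pure_states. hermitian (G \<rho>) \<and> op_norm (G \<rho>) \<le> B) \<and>
     (\<forall>\<rho>\<in>pure_states. \<forall>\<sigma>\<in>pure_states. op_norm (G \<rho> - G \<sigma>) \<le> L * trace_norm (\<rho> - \<sigma>))"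

definition implemented_step ::
    "('n::finite cmat \<Rightarrow> real \<Rightarrow> 'n cmat) \<Rightarrow> real \<Rightarrow> 'n cmat \<Rightarrow> 'n cmat" where
  "implemented_step V h \<rho> = V \<rho> h ** \<rho> ** dagger (V \<rho> h)"

text \<open>
  A circuit is a list of factors, read as the product from left to right (so the last list entry
  acts first).  \<open>Query\<close> and \<open>Query_Inv\<close> stand for calls to the oracle and its
  adjoint.  The non-query gates are drawn from a parameter set \<open>N\<close>: on a fixed space every unitary
  is a matrix, so ``making no use of the oracle'' is not a property of the matrix alone.
\<close>

datatype 'a gate = Query | Query_Inv | Non_Query 'a

fun gate_matrix :: "'n::finite cmat \<Rightarrow> 'n cmat gate \<Rightarrow> 'n cmat" where
  "gate_matrix U Query = U"
| "gate_matrix U Query_Inv = dagger U"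
| "gate_matrix U (Non_Query A) = A"

fun circuit_matrix :: "'n::finite cmat \<Rightarrow> 'n cmat gate list \<Rightarrow> 'n cmat" where
  "circuit_matrix U [] = mat 1"
| "circuit_matrix U (g # gs) = gate_matrix U g ** circuit_matrix U gs"

definition num_queries :: "'a gate list \<Rightarrow> nat" where
  "num_queries gs = length (filter (\<lambda>g. g = Query \<or> g = Query_Inv) gs)"

text \<open>\<open>N\<close> is closed under adjoints so that reversing a circuit costs no additional queries.\<close>

definition non_query_gates :: "complex ^ 'n::finite \<Rightarrow> 'n cmat set \<Rightarrow> bool" where
  "non_query_gates ket0 N \<longleftrightarrow>
     (\<forall>A\<in>N. unitary A \<and> dagger A \<in> N) \<and>
     (\<forall>\<theta>::real. mat_exp (cscale (\<i> * of_real \<theta>) (ketbra ket0)) \<in> N)"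

definition implements ::
    "'n::finite cmat set \<Rightarrow> 'n cmat \<Rightarrow> 'n cmat gate list \<Rightarrow> 'n cmat \<Rightarrow> bool" where
  "implements N U gs X \<longleftrightarrow>
     (\<forall>A. Non_Query A \<in> set gs \<longrightarrow> A \<in> N) \<and>
     (\<exists>\<omega>. cmod \<omega> = 1 \<and> X = cscale \<omega> (circuit_matrix U gs))"

definition implementable_within ::
    "'n::finite cmat set \<Rightarrow> 'n cmat \<Rightarrow> 'n cmat \<Rightarrow> nat \<Rightarrow> bool" where
  "implementable_within N U X b \<longleftrightarrow> (\<exists>gs. implements N U gs X \<and> num_queries gs \<le> b)"

fun inverse_gate :: "'n::finite cmat gate \<Rightarrow> 'n cmat gate" where
  "inverse_gate Query = Query_Inv"
| "inverse_gate Query_Inv = Query"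
| "inverse_gate (Non_Query A) = Non_Query (dagger A)"

definition inverse_circuit :: "'n::finite cmat gate list \<Rightarrow> 'n cmat gate list" where
  "inverse_circuit gs = rev (map inverse_gate gs)"

fun expand_gate :: "'n::finite cmat gate list \<Rightarrow> 'n cmat gate \<Rightarrow> 'n cmat gate list" where
  "expand_gate C Query = C"
| "expand_gate C Query_Inv = inverse_circuit C"
| "expand_gate C (Non_Query A) = [Non_Query A]"

text \<open>
  If \<open>W j\<close> is a circuit for \<open>V(\<rho>\<^sub>j, \<tau>)\<close> with oracle \<open>U\<^sub>j\<close>, then \<open>expansion W k\<close> is the circuit for
  \<open>U\<^sub>k\<close> with oracle \<open>U\<^sub>0\<close> obtained by unfolding \<open>U\<^sub>j\<^sub>+\<^sub>1 = V(\<rho>\<^sub>j, \<tau>) U\<^sub>j\<close>.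
\<close>

fun expansion :: "(nat \<Rightarrow> 'n::finite cmat gate list) \<Rightarrow> nat \<Rightarrow> 'n cmat gate list" where
  "expansion W 0 = [Query]"
| "expansion W (Suc j) = concat (map (expand_gate (expansion W j)) (W j)) @ expansion W j"

definition V_Gen ::
    "('n::finite cmat \<Rightarrow> real \<Rightarrow> 'n cmat) \<Rightarrow> 'n cmat \<Rightarrow> real \<Rightarrow> 'n cmat" where
  "V_Gen A \<rho> \<tau> =
     (let s = sqrt (\<tau> / 2); E = (\<lambda>\<theta>::real. mat_exp (cscale (\<i> * of_real \<theta>) \<rho>))
      in A \<rho> s ** E s ** A \<rho> (-s) ** E (-s) ** A \<rho> (-s) ** E (-s) ** A \<rho> s ** E s)"

definition V_NLSE ::
    "('n::finite cmat \<Rightarrow> real \<Rightarrow> 'n cmat) \<Rightarrow> 'n cmat \<Rightarrow> real \<Rightarrow> 'n cmat" where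
  "V_NLSE A \<rho> \<tau> =
     (let R = mat 1 - 2 *\<^sub>R \<rho>
      in A \<rho> (- (\<tau> / 2)) ** R ** A \<rho> (\<tau> / 2) ** R)"

definition Gen_subroutine ::
    "('n::finite cmat \<Rightarrow> 'n cmat) \<Rightarrow> real \<Rightarrow> ('n cmat \<Rightarrow> real \<Rightarrow> 'n cmat) \<Rightarrow> bool" where
  "Gen_subroutine G c A \<longleftrightarrow> 0 < c \<and>
     (\<forall>\<rho>\<in>pure_states. \<forall>\<theta>. unitary (A \<rho> \<theta>)) \<and>
     (\<forall>\<rho>\<in>pure_states. \<forall>\<tau>. 0 < \<tau> \<and> \<tau> \<le> 1 \<longrightarrow>
        (\<forall>\<theta>\<in>{sqrt (\<tau> / 2), - sqrt (\<tau> / 2)}.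
           op_norm (A \<rho> \<theta> - mat_exp (cscale (\<i> * of_real \<theta>) (G \<rho>))) \<le> c * \<tau>\<^sup>2))"

definition NLSE_subroutine ::
    "('n::finite cmat \<Rightarrow> 'n cmat) \<Rightarrow> real \<Rightarrow> ('n cmat \<Rightarrow> real \<Rightarrow> 'n cmat) \<Rightarrow> bool" where
  "NLSE_subroutine H c A \<longleftrightarrow> 0 < c \<and>
     (\<forall>\<rho>\<in>pure_states. \<forall>\<theta>. unitary (A \<rho> \<theta>)) \<and>
     (\<forall>\<rho>\<in>pure_states. \<forall>\<theta>. 0 < \<bar>\<theta>\<bar> \<and> \<bar>\<theta>\<bar> \<le> 1 \<longrightarrow>
        op_norm (A \<rho> \<theta> - mat_exp (cscale (\<i> * of_real \<theta>) (H \<rho>))) \<le> c * \<theta>\<^sup>2)"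

end

theory Submission
  imports Defs
begin

text \<open>
  On differences of pure states the trace norm is \<open>sqrt 2\<close> times the Frobenius norm, so it
  satisfies the triangle inequality there, and the double-bracket field is Lipschitz for the Euclidean
  structure of the matrix space. Gronwall's argument then gives uniqueness, hence the semigroup property
  of the flow. Comparing \<open>\<rho>\<^sub>k\<^sub>+\<^sub>1\<close> with one exact step from \<open>\<rho>\<^sub>k\<close> and then with one exact step from
  \<open>\<rho>(k\<tau>)\<close> yields the recursion \<open>e\<^sub>k\<^sub>+\<^sub>1 \<le> C \<tau>\<^sup>2 + \<Lambda>(\<tau>) e\<^sub>k\<close>, whose solution is a geometric sum. Queries
  multiply under substitution of circuits, so \<open>Q\<^sub>k\<^sub>+\<^sub>1 \<le> (1 + b) Q\<^sub>k\<close>. Since \<open>e\<^sup>i\<^sup>\<theta>\<^sup>\<rho>\<close> is conjugate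
  by \<open>U\<^sub>k\<close> to a non-query gate it costs two queries, and the reflection \<open>R\<^sub>\<rho>\<close> is the case \<open>\<theta> = \<pi>\<close>.
\<close>

section \<open>Operators\<close>

lemma dagger_dagger [simp]: "dagger (dagger A) = A"
  by (simp add: dagger_def vec_eq_iff)

lemma dagger_mult: "dagger (A ** B) = dagger B ** dagger A"
  by (simp add: dagger_def matrix_matrix_mult_def vec_eq_iff mult.commute)

lemma dagger_mat_1 [simp]: "dagger (mat 1) = mat 1"
  by (auto simp: dagger_def mat_def vec_eq_iff)

lemma dagger_diff: "dagger (A - B) = dagger A - dagger B"
  by (simp add: dagger_def vec_eq_iff)

lemma dagger_scaleR: "dagger (r *\<^sub>R A) = r *\<^sub>R dagger A"
  by (simp add: dagger_def vec_eq_iff)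

lemma dagger_cscale: "dagger (cscale c A) = cscale (cnj c) (dagger A)"
  by (simp add: dagger_def cscale_def vec_eq_iff)

lemma cscale_cscale [simp]: "cscale a (cscale b A) = cscale (a * b) A"
  by (simp add: cscale_def vec_eq_iff mult.assoc)

lemma cscale_1 [simp]: "cscale 1 A = A"
  by (simp add: cscale_def vec_eq_iff)

lemma cscale_mult_left: "cscale c A ** B = cscale c (A ** B)"
  by (simp add: cscale_def matrix_matrix_mult_def vec_eq_iff sum_distrib_left mult.assoc)

lemma cscale_mult_right: "A ** cscale c B = cscale c (A ** B)"
  by (simp add: cscale_def matrix_matrix_mult_def vec_eq_iff sum_distrib_left algebra_simps)

lemma scaleR_matrix_mult_left: "(r *\<^sub>R A) ** B = r *\<^sub>R (A ** B)" for A B :: "'n::finite cmat"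
  by (simp add: matrix_matrix_mult_def vec_eq_iff scaleR_right.sum)

lemma scaleR_matrix_mult_right: "A ** (r *\<^sub>R B) = r *\<^sub>R (A ** B)" for A B :: "'n::finite cmat"
  by (simp add: matrix_matrix_mult_def vec_eq_iff scaleR_right.sum)

lemma matrix_diff_ldistrib: "A ** (B - C) = A ** B - A ** C" for A B C :: "'n::finite cmat"
  by (simp add: matrix_matrix_mult_def vec_eq_iff right_diff_distrib sum_subtractf)

lemma matrix_diff_rdistrib: "(B - C) ** A = B ** A - C ** A" for A B C :: "'n::finite cmat"
  by (simp add: matrix_matrix_mult_def vec_eq_iff left_diff_distrib sum_subtractf)

lemma matrix_add_rdistrib: "(B + C) ** A = B ** A + C ** A" for A B C :: "'n::finite cmat"
  by (simp add: matrix_matrix_mult_def vec_eq_iff distrib_right sum.distrib)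

lemma matrix_scaleR_vector: "(r *\<^sub>R A) *v x = r *\<^sub>R (A *v x)"
  for A :: "'n::finite cmat"
  by (simp add: matrix_vector_mult_def vec_eq_iff scaleR_right.sum)

section \<open>Real inner product, adjoints and the Frobenius norm\<close>

lemma Re_cinner: "Re (cinner x y) = x \<bullet> y"
  by (simp add: cinner_def inner_vec_def inner_complex_def)

lemma cinner_self: "cinner x x = of_real ((norm x)\<^sup>2)"
  by (simp add: cinner_def power2_norm_eq_inner inner_vec_def complex_eq_iff inner_complex_def)

lemma inner_adjoint: "x \<bullet> (A *v y) = (dagger A *v x) \<bullet> y"
proof -
  have "cinner x (A *v y) = cinner (dagger A *v x) y"
    by (simp add: cinner_def matrix_vector_mult_def dagger_def sum_distrib_left sum_distrib_right)
      (subst sum.swap, simp add: mult_ac)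
  thus ?thesis by (metis Re_cinner)
qed

lemma inner_hermitian: "hermitian A \<Longrightarrow> x \<bullet> (A *v y) = (A *v x) \<bullet> y"
  by (simp add: inner_adjoint hermitian_def)

text \<open>The library norm of a matrix is the Euclidean norm of its entries, hence the
  Hilbert-Schmidt norm; this links it to traces of products.\<close>

lemma power2_norm_eq_trace: "(norm A)\<^sup>2 = Re (trace (dagger A ** A))"
  by (simp add: power2_norm_eq_inner inner_vec_def trace_def dagger_def matrix_matrix_mult_def
      inner_complex_def) (subst sum.swap, simp)

section \<open>Rank-one projections\<close>

lemma mult_ketbra: "A ** ketbra x ** dagger A = ketbra (A *v x)"
proof -
  have "(A ** ketbra x) $ i $ k = (A *v x) $ i * cnj (x $ k)" for i k
    by (simp add: matrix_matrix_mult_def matrix_vector_mult_def ketbra_def sum_distrib_right mult.assoc)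
  then have "(A ** ketbra x ** dagger A) $ i $ j = (A *v x) $ i * cnj ((A *v x) $ j)" for i j
    by (simp add: matrix_matrix_mult_def [of "A ** ketbra x"] matrix_vector_mult_def [of A x]
        dagger_def sum_distrib_left mult_ac)
  then show ?thesis by (simp add: ketbra_def vec_eq_iff)
qed

lemma hermitian_ketbra: "hermitian (ketbra x)"
  by (simp add: hermitian_def ketbra_def dagger_def vec_eq_iff mult.commute)

lemma ketbra_mult_vec: "ketbra x *v y = (\<chi> i. cinner x y * x $ i)"
  by (simp add: ketbra_def cinner_def matrix_vector_mult_def vec_eq_iff sum_distrib_left sum_distrib_right mult_ac)

lemma ketbra_scale: "ketbra (\<chi> i. c * x $ i) = (cmod c)\<^sup>2 *\<^sub>R ketbra x"
proof -
  have "c * x $ i * cnj (c * x $ j) = (c * cnj c) * (x $ i * cnj (x $ j))" for i j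
    by (simp add: mult_ac)
  thus ?thesis
    by (simp add: ketbra_def vec_eq_iff complex_norm_square [symmetric] scaleR_conv_of_real [where 'a = complex])
qed

lemma trace_ketbra: "trace (ketbra x) = cinner x x"
  by (simp add: ketbra_def trace_def cinner_def mult.commute)

lemma ketbra_idem: "cinner x x = 1 \<Longrightarrow> ketbra x ** ketbra x = ketbra x"
proof -
  assume x: "cinner x x = 1"
  have "cinner x (\<chi> i. c * x $ i) = c * cinner x x" for c
    by (simp add: cinner_def sum_distrib_left mult_ac)
  then have "ketbra x *v (ketbra x *v y) = ketbra x *v y" for y
    using x by (simp add: ketbra_mult_vec)
  thus ?thesis by (simp add: matrix_eq flip: matrix_vector_mul_assoc)
qed

text \<open>Since \<open>ketbra x\<close> is its own adjoint, the product is the conjugation of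
  \<open>ketbra y\<close> by it, that is, the ketbra of a multiple of \<open>x\<close>. The factor
  is the transition probability when both vectors are normalized.\<close>

lemma ketbra_sandwich:
  "ketbra x ** ketbra y ** ketbra x = (cmod (cinner x y))\<^sup>2 *\<^sub>R ketbra x"
proof -
  have "dagger (ketbra x) = ketbra x"
    using hermitian_ketbra by (simp add: hermitian_def)
  then show ?thesis
    using mult_ketbra [of "ketbra x" y] by (simp add: ketbra_mult_vec ketbra_scale)
qed

lemma unitary_norm: "unitary A \<Longrightarrow> norm (A *v x) = norm x"
proof -
  assume "unitary A"
  then have "(A *v x) \<bullet> (A *v x) = x \<bullet> x"
    by (subst inner_adjoint) (simp add: matrix_vector_mul_assoc unitary_def)
  then show ?thesis by (simp add: norm_eq_sqrt_inner)
qed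

lemma unitary_mult: "unitary A \<Longrightarrow> unitary B \<Longrightarrow> unitary (A ** B)"
  unfolding unitary_def dagger_mult
  by (metis matrix_mul_assoc matrix_mul_rid)

lemma pure_states_unitary: "unitary A \<Longrightarrow> cinner x x = 1 \<Longrightarrow> ketbra (A *v x) \<in> pure_states"
  unfolding pure_states_def by (auto simp: cinner_self unitary_norm)

section \<open>The trace distance of pure states\<close>

text \<open>With \<open>D = B - C\<close>, the hypotheses give \<open>D ** (B + C) = 0\<close>.
  Positivity of both roots makes their quadratic forms vanish separately on the range of
  \<open>D\<close>, so \<open>D\<close> cubed has zero quadratic form; a Hermitian matrix with this
  property is zero.\<close>

lemma psd_sqrt_unique:
  assumes B: "psd B" and C: "psd C" and sq: "B ** B = C ** C" and comm: "B ** C = C ** B"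
  shows "B = C"
proof -
  define D where "D = B - C"
  have hD: "hermitian D"
    using B C by (simp add: D_def psd_def hermitian_def dagger_diff)
  have "D ** (B + C) = 0"
    by (simp add: D_def matrix_diff_rdistrib matrix_add_ldistrib sq comm)
  then have z: "D *v (B *v y) + D *v (C *v y) = 0" for y
    by (metis matrix_vector_mul_assoc matrix_vector_mult_0 matrix_vector_right_distrib
        matrix_vector_mult_add_rdistrib)
  have quad: "(D *v x) \<bullet> (D *v (D *v x)) = 0" for x
  proof -
    let ?y = "D *v x"
    have "?y \<bullet> (B *v ?y) + ?y \<bullet> (C *v ?y) = x \<bullet> (D *v (B *v ?y) + D *v (C *v ?y))"
      by (simp add: inner_add_right inner_hermitian [OF hD])
    then have "?y \<bullet> (B *v ?y) + ?y \<bullet> (C *v ?y) = 0" by (simp add: z)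
    moreover have "0 \<le> ?y \<bullet> (B *v ?y)" "0 \<le> ?y \<bullet> (C *v ?y)"
      using B C by (auto simp: psd_def Re_cinner)
    ultimately have "?y \<bullet> (B *v ?y) = 0" "?y \<bullet> (C *v ?y) = 0" by linarith+
    then have "?y \<bullet> (B *v ?y - C *v ?y) = 0" by (simp add: inner_diff_right)
    then show ?thesis by (simp add: D_def matrix_vector_mult_diff_rdistrib)
  qed
  have "D *v x = 0" for x
  proof -
    let ?y = "D *v x"
    have sym: "(D *v u) \<bullet> v = u \<bullet> (D *v v)" for u v by (simp add: inner_hermitian [OF hD])
    \<comment> \<open>Polarization: \<open>quad\<close> at \<open>x\<close>, at \<open>?y\<close>
      and at their sum isolates the mixed term.\<close>
    have "?y \<bullet> (D *v (D *v ?y)) = 0"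
      using quad [of "x + ?y"] quad [of x] quad [of ?y]
      by (simp add: matrix_vector_right_distrib inner_add_left inner_add_right sym)
    then have "(D *v ?y) \<bullet> (D *v ?y) = 0" by (simp add: sym)
    then have "D *v ?y = 0" by simp
    then have "?y \<bullet> ?y = 0" by (simp add: sym)
    then show ?thesis by simp
  qed
  then have "D = 0" by (simp add: matrix_eq)
  then show ?thesis by (simp add: D_def)
qed

text \<open>The difference \<open>X\<close> of two pure states satisfies \<open>X\<^sup>3 = c X\<close> with \<open>2 c = tr X\<^sup>2\<close>, so
  \<open>X\<^sup>2 / sqrt c\<close> is the positive root of \<open>X\<^sup>2\<close>.\<close>

lemma psd_sqrt_cubic:
  fixes X :: "'n::finite cmat"
  assumes h: "hermitian X" and c: "c > 0" and cubic: "X ** X ** X = c *\<^sub>R X"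
  shows "psd_sqrt (X ** X) = (1 / sqrt c) *\<^sub>R (X ** X)"
proof -
  let ?C = "(1 / sqrt c) *\<^sub>R (X ** X)"
  have 1: "psd ?C"
  proof -
    \<comment> \<open>One Hermitian factor is moved to the left side, which exhibits the form as a
      square.\<close>
    have "x \<bullet> (?C *v x) = (norm (X *v x))\<^sup>2 / sqrt c" for x
      by (simp add: matrix_scaleR_vector power2_norm_eq_inner inner_hermitian [OF h]
          flip: matrix_vector_mul_assoc)
    then show ?thesis
      using h c by (simp add: psd_def hermitian_def dagger_scaleR dagger_mult Re_cinner)
  qed
  have "X ** X ** (X ** X) = c *\<^sub>R (X ** X)"
    using cubic by (metis matrix_mul_assoc scaleR_matrix_mult_left)
  then have 2: "?C ** ?C = X ** X"
    using c by (simp add: scaleR_matrix_mult_left scaleR_matrix_mult_right)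
  show ?thesis
    unfolding psd_sqrt_def
  proof (rule the_equality)
    show "psd ?C \<and> ?C ** ?C = X ** X" using 1 2 by simp
  next
    fix B assume B: "psd B \<and> B ** B = X ** X"
    \<comment> \<open>Any root \<open>B\<close> commutes with its own square \<open>X ** X\<close>,
      of which \<open>?C\<close> is a multiple, so uniqueness among commuting roots
      suffices.\<close>
    then have "B ** ?C = ?C ** B"
      by (simp add: scaleR_matrix_mult_left scaleR_matrix_mult_right) (metis matrix_mul_assoc)
    then show "B = ?C" using B 1 2 psd_sqrt_unique [of B ?C] by metis
  qed
qed

text \<open>Covers coinciding states, where the cubic relation has \<open>c = 0\<close>.\<close>

lemma psd_sqrt_0: "psd_sqrt 0 = 0"
  unfolding psd_sqrt_def
proof (rule the_equality)
  have "hermitian 0" by (simp add: hermitian_def dagger_def vec_eq_iff)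
  then show *: "psd 0 \<and> 0 ** 0 = 0" by (simp add: psd_def Re_cinner)
  fix B :: "'a cmat" assume "psd B \<and> B ** B = 0"
  moreover have "B ** 0 = 0" "0 ** B = 0" by (simp_all add: matrix_matrix_mult_def vec_eq_iff)
  ultimately show "B = 0" using * psd_sqrt_unique [of B 0] by simp
qed

text \<open>For distinct states the nonzero eigenvalues of \<open>P - Q\<close> are plus and minus
  \<open>sqrt c\<close>, so the trace norm is \<open>2 * sqrt c\<close> and the Frobenius norm is
  \<open>sqrt (2 * c)\<close>. The cubic relation replaces diagonalization.\<close>

lemma trace_norm_pure_diff:
  assumes "P \<in> pure_states" "Q \<in> pure_states"
  shows "trace_norm (P - Q) = sqrt 2 * norm (P - Q)"
proof -
  obtain x y where x: "P = ketbra x" "cinner x x = 1" and y: "Q = ketbra y" "cinner y y = 1"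
    using assms by (auto simp: pure_states_def)
  define X where "X = P - Q"
  \<comment> \<open>Defined through the norm, \<open>c\<close> is positive as soon as
    \<open>X \<noteq> 0\<close>; the trace computation identifies it with
    \<open>1 - a\<close>.\<close>
  define c where "c = (norm X)\<^sup>2 / 2"
  define a where "a = (cmod (cinner x y))\<^sup>2"
  have "cinner y x = cnj (cinner x y)" by (simp add: cinner_def mult.commute)
  then have a': "a = (cmod (cinner y x))\<^sup>2" by (simp add: a_def)
  have PQP: "P ** Q ** P = a *\<^sub>R P" using x y by (simp add: ketbra_sandwich a_def)
  have QPQ: "Q ** P ** Q = a *\<^sub>R Q" using x y by (simp add: ketbra_sandwich a')
  have idem: "P ** P = P" "Q ** Q = Q" using x y ketbra_idem by auto
  have h: "hermitian X"
    using hermitian_ketbra [of x] hermitian_ketbra [of y] x y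
    by (simp add: hermitian_def X_def dagger_diff)
  have X2: "X ** X = P + Q - P ** Q - Q ** P"
    by (simp add: X_def matrix_diff_ldistrib matrix_diff_rdistrib idem)
  have "trace (P ** Q ** P) = trace (P ** P ** Q)" using trace_mul_sym [of "P ** Q" P] by (simp add: matrix_mul_assoc)
  then have "trace (P ** Q) = trace (a *\<^sub>R P)" by (simp add: idem PQP)
  also have "trace (a *\<^sub>R P) = of_real a"
    using x trace_ketbra [of x] by (simp add: trace_def flip: scaleR_right.sum)
      (simp add: scaleR_conv_of_real)
  finally have trPQ: "trace (P ** Q) = of_real a" .
  have "trace (X ** X) = of_real (2 - 2 * a)"
    using trPQ trace_mul_sym [of Q P] x y trace_ketbra [of x] trace_ketbra [of y]
    by (simp add: X2 trace_add trace_sub)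
  moreover have nX: "(norm X)\<^sup>2 = Re (trace (X ** X))"
    using power2_norm_eq_trace [of X] h by (simp add: hermitian_def)
  ultimately have c: "c = 1 - a" by (simp add: c_def)
  \<comment> \<open>On \<open>P\<close> the terms \<open>Q ** P\<close> cancel and the sandwich
    contributes \<open>- a\<close>, leaving \<open>1 - a = c\<close>; symmetrically on
    \<open>Q\<close>.\<close>
  have "X ** X ** P = c *\<^sub>R P" "X ** X ** Q = c *\<^sub>R Q"
    unfolding X2 c matrix_diff_rdistrib matrix_add_rdistrib PQP QPQ idem
    by (simp_all add: PQP QPQ idem scaleR_left_diff_distrib flip: matrix_mul_assoc)
  then have cubic: "X ** X ** X = c *\<^sub>R X"
    by (simp add: X_def matrix_diff_ldistrib scaleR_right_diff_distrib)
  have "trace_norm X = sqrt 2 * norm X"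
  proof (cases "X = 0")
    case True
    then show ?thesis by (simp add: trace_norm_def psd_sqrt_0 trace_def)
  next
    case False
    then have c0: "c > 0" by (simp add: c_def)
    have "trace_norm X = Re (trace ((1 / sqrt c) *\<^sub>R (X ** X)))"
      using h psd_sqrt_cubic [OF h c0 cubic] by (simp add: trace_norm_def hermitian_def)
    also have "\<dots> = (norm X)\<^sup>2 / sqrt c"
      by (simp add: nX trace_def sum_divide_distrib)
    also have "\<dots> = sqrt 2 * norm X"
      by (simp add: c_def real_sqrt_divide power2_eq_square)
    finally show ?thesis .
  qed
  then show ?thesis by (simp add: X_def)
qed

section \<open>Uniqueness of the flow\<close>

text \<open>Each entry is a coordinate of the image of a basis vector, and sums dominate Euclidean
  norms. The crude constant is harmless, since only some finite Lipschitz constant of the field is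
  wanted.\<close>

lemma norm_le_op_norm: "norm A \<le> (real CARD('n))\<^sup>2 * op_norm A" for A :: "'n::finite cmat"
proof -
  have entry: "norm (A $ i $ j) \<le> op_norm A" for i j
  proof -
    have "A $ i $ j = (A *v axis j 1) $ i"
      by (simp add: matrix_vector_mult_def axis_def if_distrib [of "\<lambda>c. _ * c"] cong: if_cong)
    then have "norm (A $ i $ j) \<le> norm (A *v axis j 1)"
      by (simp only: Finite_Cartesian_Product.norm_nth_le)
    also have "\<dots> \<le> op_norm A * norm (axis j (1::complex) :: complex ^ 'n)"
      unfolding op_norm_def by (intro onorm matrix_vector_mul_bounded_linear)
    finally show ?thesis
      by (simp add: norm_eq_sqrt_inner [of "axis j 1"] inner_axis_axis inner_complex_def)
  qed
  have row: "norm (A $ i) \<le> real CARD('n) * op_norm A" for i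
  proof -
    have "norm (A $ i) \<le> (\<Sum>j\<in>UNIV. norm (A $ i $ j))"
      unfolding norm_vec_def by (intro L2_set_le_sum) simp
    also have "\<dots> \<le> (\<Sum>j\<in>(UNIV::'n set). op_norm A)" by (intro sum_mono entry)
    finally show ?thesis by simp
  qed
  have "norm A \<le> (\<Sum>i\<in>UNIV. norm (A $ i))"
    unfolding norm_vec_def [of A] by (intro L2_set_le_sum) simp
  also have "\<dots> \<le> (\<Sum>i\<in>(UNIV::'n set). real CARD('n) * op_norm A)" by (intro sum_mono row)
  finally show ?thesis by (simp add: power2_eq_square mult.assoc)
qed

text \<open>In finite dimension bilinearity implies boundedness; this supplies both the norm
  estimate and the difference rules for the bracket.\<close>

lemma bounded_bilinear_commutator: "bounded_bilinear (commutator :: 'n::finite cmat \<Rightarrow> _)"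
proof -
  have "bilinear (commutator :: 'n cmat \<Rightarrow> _)"
    unfolding bilinear_def commutator_def
    by (auto intro!: linearI simp: matrix_add_ldistrib matrix_add_rdistrib scaleR_matrix_mult_left
        scaleR_matrix_mult_right scaleR_right_diff_distrib)
  then show ?thesis by (simp add: bilinear_conv_bounded_bilinear)
qed

text \<open>Gronwall in differential form: the squared distance of two solutions, damped by
  \<open>exp (- 2 * K * s)\<close>, is nonincreasing and starts at zero. The set \<open>S\<close>
  allows a field that is Lipschitz only on pure states.\<close>

lemma ode_unique:
  fixes x y :: "real \<Rightarrow> 'a::real_inner"
  assumes x: "\<And>t. t \<ge> 0 \<Longrightarrow> (x has_vector_derivative F (x t)) (at t within {0..})"
    and y: "\<And>t. t \<ge> 0 \<Longrightarrow> (y has_vector_derivative F (y t)) (at t within {0..})"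
    and S: "\<And>t. t \<ge> 0 \<Longrightarrow> x t \<in> S" "\<And>t. t \<ge> 0 \<Longrightarrow> y t \<in> S"
    and lip: "\<And>u v. u \<in> S \<Longrightarrow> v \<in> S \<Longrightarrow> norm (F u - F v) \<le> K * norm (u - v)"
    and init: "x 0 = y 0" and t: "t \<ge> 0"
  shows "x t = y t"
proof -
  define d where "d s = x s - y s" for s
  define g where "g s = exp (- 2 * K * s) * (d s \<bullet> d s)" for s
  have d: "(d has_derivative (\<lambda>r. r *\<^sub>R (F (x s) - F (y s)))) (at s within {0..})" if "s \<ge> 0" for s
    using has_vector_derivative_diff [OF x y, OF that that]
    by (simp add: has_vector_derivative_def d_def [abs_def])
  have g: "(g has_real_derivative exp (- 2 * K * s) * (2 * (d s \<bullet> (F (x s) - F (y s)))) - 2 * K * g s)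
      (at s within {0..})" if "s \<ge> 0" for s
    unfolding g_def [abs_def] has_field_derivative_def
    by (rule derivative_eq_intros d [OF that] refl)+
      (auto simp: fun_eq_iff algebra_simps inner_commute)
  have "g t \<le> g 0"
  \<comment> \<open>At time 0 only a one-sided derivative exists. It yields continuity there, while
    the sign condition is checked in the open interval.\<close>
  proof (rule DERIV_nonpos_imp_decreasing_open [where f = g])
    fix s assume "0 < s" "s < t"
    have "d s \<bullet> (F (x s) - F (y s)) \<le> norm (d s) * norm (F (x s) - F (y s))"
      by (rule norm_cauchy_schwarz)
    also have "\<dots> \<le> norm (d s) * (K * norm (d s))"
      using \<open>0 < s\<close> S by (intro mult_left_mono) (auto simp: d_def lip)
    also have "\<dots> = K * (d s \<bullet> d s)" by (simp add: dot_square_norm power2_eq_square)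
    finally have "exp (- 2 * K * s) * (2 * (d s \<bullet> (F (x s) - F (y s)))) - 2 * K * g s \<le> 0"
      by (simp add: g_def mult.left_commute [of "2 * K"])
    moreover have "at s within {0..} = at s"
      using \<open>0 < s\<close> by (intro at_within_interior) simp
    ultimately show "\<exists>y. (g has_real_derivative y) (at s) \<and> y \<le> 0"
      using g [of s] \<open>0 < s\<close> by auto
  next
    show "continuous_on {0..t} g"
      by (rule continuous_on_subset [of "{0..}"])
        (auto simp: continuous_on_eq_continuous_within intro!: DERIV_continuous g)
  qed (use t in auto)
  moreover have "g 0 = 0" by (simp add: g_def d_def init)
  ultimately have "d t \<bullet> d t \<le> 0" by (simp add: g_def mult_le_0_iff)
  then have "d t = 0" by (metis inner_gt_zero_iff not_less)
  then show ?thesis by (simp add: d_def)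
qed

section \<open>Lipschitz continuity of the double-bracket field and the semigroup law\<close>

lemma norm_pure_state:
  assumes "P \<in> pure_states"
  shows "norm P = 1"
proof -
  obtain x where x: "P = ketbra x" "cinner x x = 1" using assms by (auto simp: pure_states_def)
  then have "(norm P)\<^sup>2 = 1"
    using hermitian_ketbra [of x]
    by (simp add: power2_norm_eq_trace hermitian_def ketbra_idem trace_ketbra)
  then show ?thesis using norm_ge_zero [of P] by (simp only: power2_eq_1_iff) linarith
qed

text \<open>Differences of products are telescoped, first in the inner and then in the outer
  bracket; every factor is bounded and Lipschitz on pure states.\<close>

lemma double_bracket_lipschitz:
  fixes G :: "'n::finite cmat \<Rightarrow> 'n cmat"
  assumes "bounded_lipschitz_generator G B L"
  obtains K where "\<And>\<rho> \<sigma>. \<rho> \<in> pure_states \<Longrightarrow> \<sigma> \<in> pure_states \<Longrightarrow>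
    norm (commutator (commutator \<rho> (G \<rho>)) \<rho> - commutator (commutator \<sigma> (G \<sigma>)) \<sigma>)
      \<le> K * norm (\<rho> - \<sigma>)"
proof -
  interpret bounded_bilinear "commutator :: 'n cmat \<Rightarrow> 'n cmat \<Rightarrow> 'n cmat"
    by (rule bounded_bilinear_commutator)
  obtain C where C: "C \<ge> 0" "\<And>X Y :: 'n cmat. norm (commutator X Y) \<le> norm X * norm Y * C"
    using nonneg_bounded by blast
  \<comment> \<open>\<open>b\<close> and \<open>l\<close> are the bound and the Lipschitz constant
    of \<open>G\<close> in the Frobenius norm; \<open>sqrt 2\<close> converts the trace
    distance.\<close>
  define b where "b = (real CARD('n))\<^sup>2 * B"
  define l where "l = (real CARD('n))\<^sup>2 * (L * sqrt 2)"
  have BL: "B \<ge> 0" "L \<ge> 0" using assms by (auto simp: bounded_lipschitz_generator_def)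
  then have bl: "b \<ge> 0" "l \<ge> 0" by (auto simp: b_def l_def)
  have Gb: "norm (G \<rho>) \<le> b" if "\<rho> \<in> pure_states" for \<rho>
    using assms that norm_le_op_norm [of "G \<rho>"]
    by (auto simp: b_def bounded_lipschitz_generator_def intro: order_trans mult_left_mono)
  have Gl: "norm (G \<rho> - G \<sigma>) \<le> l * norm (\<rho> - \<sigma>)" if "\<rho> \<in> pure_states" "\<sigma> \<in> pure_states" for \<rho> \<sigma>
  proof -
    have "op_norm (G \<rho> - G \<sigma>) \<le> L * (sqrt 2 * norm (\<rho> - \<sigma>))"
      using assms that by (metis bounded_lipschitz_generator_def trace_norm_pure_diff)
    then show ?thesis
      using norm_le_op_norm [of "G \<rho> - G \<sigma>"]
      by (auto simp: l_def mult.assoc intro: order_trans mult_left_mono)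
  qed
  show ?thesis
  \<comment> \<open>The first summand comes from varying the inner bracket, the second from varying
    the outer state; each bracket costs a factor \<open>C\<close>.\<close>
  proof (rule that [of "(b + l) * C * C + b * C * C"])
    fix \<rho> \<sigma> :: "'n cmat" assume p: "\<rho> \<in> pure_states" "\<sigma> \<in> pure_states"
    let ?\<delta> = "norm (\<rho> - \<sigma>)"
    have n: "norm \<rho> = 1" "norm \<sigma> = 1" using p norm_pure_state by auto
    have "commutator \<rho> (G \<rho>) - commutator \<sigma> (G \<sigma>)
        = commutator (\<rho> - \<sigma>) (G \<rho>) + commutator \<sigma> (G \<rho> - G \<sigma>)"
      by (simp add: diff_left diff_right)
    then have "norm (commutator \<rho> (G \<rho>) - commutator \<sigma> (G \<sigma>))
        \<le> ?\<delta> * norm (G \<rho>) * C + norm (G \<rho> - G \<sigma>) * C"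
      using C(2) [of "\<rho> - \<sigma>" "G \<rho>"] C(2) [of \<sigma> "G \<rho> - G \<sigma>"]
      by (simp add: n) (smt (verit) norm_triangle_ineq)
    also have "\<dots> \<le> ?\<delta> * b * C + l * ?\<delta> * C"
      using p C(1) by (intro add_mono mult_right_mono mult_left_mono Gb Gl) auto
    finally have 1: "norm (commutator \<rho> (G \<rho>) - commutator \<sigma> (G \<sigma>)) \<le> (b + l) * C * ?\<delta>"
      by (simp add: algebra_simps)
    have 2: "norm (commutator \<sigma> (G \<sigma>)) \<le> b * C"
      using C(2) [of \<sigma> "G \<sigma>"] mult_right_mono [OF Gb [OF p(2)] C(1)] by (simp add: n)
    have "commutator (commutator \<rho> (G \<rho>)) \<rho> - commutator (commutator \<sigma> (G \<sigma>)) \<sigma>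
        = commutator (commutator \<rho> (G \<rho>) - commutator \<sigma> (G \<sigma>)) \<rho>
          + commutator (commutator \<sigma> (G \<sigma>)) (\<rho> - \<sigma>)"
      by (simp add: diff_left diff_right)
    then have "norm (commutator (commutator \<rho> (G \<rho>)) \<rho> - commutator (commutator \<sigma> (G \<sigma>)) \<sigma>)
        \<le> norm (commutator \<rho> (G \<rho>) - commutator \<sigma> (G \<sigma>)) * norm \<rho> * C
          + norm (commutator \<sigma> (G \<sigma>)) * ?\<delta> * C"
      using C(2) by (smt (verit) norm_triangle_ineq)
    also have "\<dots> \<le> (b + l) * C * ?\<delta> * norm \<rho> * C + b * C * ?\<delta> * C"
      using C(1) by (intro add_mono mult_right_mono 1 2) auto
    finally show "norm (commutator (commutator \<rho> (G \<rho>)) \<rho> - commutator (commutator \<sigma> (G \<sigma>)) \<sigma>)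
        \<le> ((b + l) * C * C + b * C * C) * ?\<delta>"
      by (simp add: n algebra_simps)
  qed
qed

text \<open>The field is autonomous, so the time-shifted trajectory and the trajectory restarted at
  \<open>\<phi> t \<rho>\<close> solve the same initial value problem.\<close>

lemma double_bracket_flow_semigroup:
  fixes G :: "'n::finite cmat \<Rightarrow> 'n cmat"
  assumes G: "bounded_lipschitz_generator G B L" and flow: "double_bracket_flow G \<phi>"
    and \<rho>: "\<rho> \<in> pure_states" and s: "s \<ge> 0" and t: "t \<ge> 0"
  shows "\<phi> s (\<phi> t \<rho>) = \<phi> (s + t) \<rho>"
proof -
  let ?F = "\<lambda>\<rho>. commutator (commutator \<rho> (G \<rho>)) \<rho>"
  obtain K where K: "\<And>\<rho> \<sigma>. \<rho> \<in> pure_states \<Longrightarrow> \<sigma> \<in> pure_states \<Longrightarrow>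
      norm (?F \<rho> - ?F \<sigma>) \<le> K * norm (\<rho> - \<sigma>)"
    using double_bracket_lipschitz [OF G] by blast
  have pure: "\<phi> r \<sigma> \<in> pure_states" if "\<sigma> \<in> pure_states" "r \<ge> 0" for r \<sigma>
    using flow that by (auto simp: double_bracket_flow_def)
  have der: "((\<lambda>r. \<phi> r \<sigma>) has_vector_derivative ?F (\<phi> r \<sigma>)) (at r within {0..})"
    if "\<sigma> \<in> pure_states" "r \<ge> 0" for r \<sigma>
    using flow that by (auto simp: double_bracket_flow_def)
  have der_shift: "((\<lambda>r. \<phi> (r + t) \<rho>) has_vector_derivative ?F (\<phi> (r + t) \<rho>)) (at r within {0..})"
    if "r \<ge> 0" for r
  proof -
    have 1: "((\<lambda>r. r + t) has_vector_derivative 1) (at r within {0..})"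
      by (auto intro!: derivative_eq_intros)
    \<comment> \<open>The chain rule asks for the derivative within the shifted half-line, a subset
      of \<open>{0..}\<close> because \<open>t \<ge> 0\<close>.\<close>
    have 2: "((\<lambda>r. \<phi> r \<rho>) has_vector_derivative ?F (\<phi> (r + t) \<rho>)) (at (r + t) within (\<lambda>r. r + t) ` {0..})"
      by (rule has_vector_derivative_within_subset [OF der]) (use that t \<rho> in auto)
    show ?thesis using vector_diff_chain_within [OF 1 2] by (simp add: o_def)
  qed
  show ?thesis
  proof (rule ode_unique [where x = "\<lambda>s. \<phi> s (\<phi> t \<rho>)" and y = "\<lambda>s. \<phi> (s + t) \<rho>"
        and F = ?F and S = pure_states and K = K])
    show "\<phi> 0 (\<phi> t \<rho>) = \<phi> (0 + t) \<rho>"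
      using flow pure [OF \<rho> t] by (simp add: double_bracket_flow_def)
  qed (use \<rho> s t in \<open>auto intro: der der_shift pure K\<close>)
qed

section \<open>Accumulation of the one-step errors\<close>

text \<open>Leaving the geometric sum unevaluated treats \<open>q < 1\<close>, \<open>q = 1\<close>
  and \<open>q > 1\<close> alike.\<close>

lemma affine_recursion_bound:
  fixes e :: "nat \<Rightarrow> real"
  assumes "e 0 = 0" and "\<And>k. k < n \<Longrightarrow> e (Suc k) \<le> c + q * e k" and "q \<ge> 0"
  shows "e n \<le> c * (\<Sum>j<n. q ^ j)"
  using assms(2)
proof (induction n)
  case 0
  then show ?case by (simp add: assms)
next
  case (Suc n)
  have "e (Suc n) \<le> c + q * e n" using Suc.prems by simp
  also have "\<dots> \<le> c + q * (c * (\<Sum>j<n. q ^ j))"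
    using Suc assms(3) by (intro add_left_mono mult_left_mono) auto
  also have "\<dots> = c * (\<Sum>j<Suc n. q ^ j)"
    by (subst sum.lessThan_Suc_shift) (simp add: algebra_simps sum_distrib_left)
  finally show ?case .
qed

text \<open>On \<open>0 < x \<le> 1\<close> one has
  \<open>exp (- x) \<le> 1 / (1 + x) \<le> 1 - x / 2\<close>, so the full geometric series is at
  most \<open>2 / x\<close>. This is the origin of the factor 2 in the contracting step
  number.\<close>

lemma geometric_le_contracting:
  fixes x :: real
  assumes "0 < x" "x \<le> 1"
  shows "(\<Sum>j<n. exp (- x) ^ j) \<le> 2 / x"
proof -
  have "1 / exp x \<le> 1 / (1 + x)" using assms exp_ge_add_one_self [of x] by (intro divide_left_mono) auto
  also have "\<dots> \<le> 1 - x / 2" using assms by (simp add: field_simps)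
  finally have q: "exp (- x) \<le> 1 - x / 2" by (simp add: exp_minus inverse_eq_divide)
  have "exp (- x) \<noteq> 1" using assms by simp
  then have "(\<Sum>j<n. exp (- x) ^ j) = (1 - exp (- x) ^ n) / (1 - exp (- x))"
    by (simp add: sum_gp_strict)
  also have "\<dots> \<le> 1 / (1 - exp (- x))"
    using assms by (intro divide_right_mono) auto
  also have "\<dots> \<le> 1 / (x / 2)"
    using assms q by (intro divide_left_mono) auto
  finally show ?thesis by simp
qed

text \<open>The denominator of the closed form satisfies \<open>exp x - 1 \<ge> x\<close>, and the
  \<open>- 1\<close> in the numerator is dropped.\<close>

lemma geometric_le_expanding:
  fixes x :: real
  assumes "0 < x"
  shows "(\<Sum>j<n. exp x ^ j) \<le> exp (real n * x) / x"
proof -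
  have "exp x \<noteq> 1" using assms by simp
  then have "(\<Sum>j<n. exp x ^ j) = (exp x ^ n - 1) / (exp x - 1)"
    by (rule geometric_sum)
  also have "\<dots> \<le> exp x ^ n / (exp x - 1)"
    using assms by (intro divide_right_mono) auto
  also have "\<dots> \<le> exp x ^ n / x"
    using assms exp_ge_add_one_self [of x] by (intro divide_left_mono mult_pos_pos; simp; linarith)
  finally show ?thesis by (simp add: exp_of_nat_mult)
qed

text \<open>The entry 1 makes \<open>M\<close> positive, \<open>T\<close> gives
  \<open>\<tau> \<le> 1\<close>, and in the contracting case \<open>lam * T\<close> gives
  \<open>lam * \<tau> \<le> 1\<close>. The last entry brings the accumulated error below
  \<open>\<epsilon>\<close>.\<close>

lemma step_number_bound:
  fixes T \<epsilon> lam C \<tau> :: real and M :: nat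
  assumes pos: "T > 0" "\<epsilon> > 0" "C > 0"
    and regime:
      "(lam > 0 \<and> (\<forall>t\<ge>0. \<Lambda> t = exp (- lam * t)) \<and>
          int M = \<lceil>Max {1, T, lam * T, 2 * C * T / (lam * \<epsilon>)}\<rceil>) \<or>
       ((\<forall>t\<ge>0. \<Lambda> t = 1) \<and>
          int M = \<lceil>Max {1, T, C * T\<^sup>2 / \<epsilon>}\<rceil>) \<or>
       (lam > 0 \<and> (\<forall>t\<ge>0. \<Lambda> t = exp (lam * t)) \<and>
          int M = \<lceil>Max {1, T, lam * T, C * T * exp (lam * T) / (lam * \<epsilon>)}\<rceil>)"
    and tau: "\<tau> = T / real M"
  shows "0 < M" "0 < \<tau>" "\<tau> \<le> 1" "0 \<le> \<Lambda> \<tau>" "C * \<tau>\<^sup>2 * (\<Sum>j<M. \<Lambda> \<tau> ^ j) \<le> \<epsilon>"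
proof -
  have le: "x \<le> real M" if "int M = \<lceil>x\<rceil>" for x
    using that by (metis le_of_int_ceiling of_int_of_nat_eq)
  have "1 \<le> real M" and TM: "T \<le> real M"
    using regime by (auto dest!: le)
  then show M: "0 < M" and tau_pos: "0 < \<tau>" and "\<tau> \<le> 1"
    using pos by (auto simp: tau divide_simps)
  have Mtau: "real M * \<tau> = T" using M by (simp add: tau)
  show "0 \<le> \<Lambda> \<tau>" using regime tau_pos by auto
  consider (contr) "lam > 0" "\<Lambda> \<tau> = exp (- (lam * \<tau>))" "lam * T \<le> M" "2 * C * T / (lam * \<epsilon>) \<le> M"
    | (neutral) "\<Lambda> \<tau> = 1" "C * T\<^sup>2 / \<epsilon> \<le> M"
    | (expand) "lam > 0" "\<Lambda> \<tau> = exp (lam * \<tau>)" "C * T * exp (lam * T) / (lam * \<epsilon>) \<le> M"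
    using regime tau_pos by (auto dest!: le)
  then show "C * \<tau>\<^sup>2 * (\<Sum>j<M. \<Lambda> \<tau> ^ j) \<le> \<epsilon>"
  proof cases
    case contr
    have "lam * \<tau> \<le> 1" using contr M by (simp add: tau divide_simps)
    then have "C * \<tau>\<^sup>2 * (\<Sum>j<M. \<Lambda> \<tau> ^ j) \<le> C * \<tau>\<^sup>2 * (2 / (lam * \<tau>))"
      unfolding contr(2) using contr pos tau_pos
      by (intro mult_left_mono geometric_le_contracting) auto
    \<comment> \<open>The sum costs one power of \<open>\<tau>\<close>; the remaining one is
      \<open>T / M\<close>, which the last entry of the maximum controls.\<close>
    also have "\<dots> = 2 * C * \<tau> / lam" using tau_pos by (simp add: power2_eq_square)
    also have "\<dots> \<le> \<epsilon>"
      using contr pos M by (simp add: tau divide_simps mult_ac)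
    finally show ?thesis .
  next
    case neutral
    \<comment> \<open>Here the sum equals \<open>M\<close>, so the error is
      \<open>C * T\<^sup>2 / M\<close>.\<close>
    then show ?thesis
      using pos M by (simp add: tau divide_simps mult_ac power2_eq_square)
  next
    case expand
    then have "C * \<tau>\<^sup>2 * (\<Sum>j<M. \<Lambda> \<tau> ^ j) \<le> C * \<tau>\<^sup>2 * (exp (real M * (lam * \<tau>)) / (lam * \<tau>))"
      unfolding expand(2) using pos tau_pos
      by (intro mult_left_mono geometric_le_expanding) auto
    also have "real M * (lam * \<tau>) = lam * T" by (simp add: Mtau [symmetric])
    also have "C * \<tau>\<^sup>2 * (exp (lam * T) / (lam * \<tau>)) = C * \<tau> * exp (lam * T) / lam"
      using tau_pos by (simp add: power2_eq_square)
    also have "\<dots> \<le> \<epsilon>"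
      using expand pos M by (simp add: tau divide_simps mult_ac)
    finally show ?thesis .
  qed
qed

section \<open>Circuits\<close>

lemma circuit_matrix_append: "circuit_matrix U (xs @ ys) = circuit_matrix U xs ** circuit_matrix U ys"
  by (induction xs) (auto simp: matrix_mul_assoc)

lemma circuit_matrix_inverse: "circuit_matrix U (inverse_circuit gs) = dagger (circuit_matrix U gs)"
proof (induction gs)
  case (Cons g gs)
  have "gate_matrix U (inverse_gate g) = dagger (gate_matrix U g)" by (cases g) auto
  then show ?case using Cons by (simp add: inverse_circuit_def circuit_matrix_append dagger_mult)
qed (simp add: inverse_circuit_def)

lemma num_queries_Nil [simp]: "num_queries [] = 0"
  by (simp add: num_queries_def)

text \<open>The head stays a one-gate circuit, so inductions reduce to a case split on gates. As a
  simplification rule it would loop on singletons.\<close>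

lemma num_queries_Cons: "num_queries (g # gs) = num_queries [g] + num_queries gs"
  by (simp add: num_queries_def)

lemma num_queries_gate [simp]:
  "num_queries [Query] = 1" "num_queries [Query_Inv] = 1" "num_queries [Non_Query A] = 0"
  by (simp_all add: num_queries_def)

lemma num_queries_append [simp]: "num_queries (xs @ ys) = num_queries xs + num_queries ys"
  by (simp add: num_queries_def)

lemma num_queries_inverse [simp]: "num_queries (inverse_circuit gs) = num_queries gs"
proof (induction gs)
  case (Cons g gs)
  have "num_queries [inverse_gate g] = num_queries [g]" by (cases g) auto
  then show ?case using Cons num_queries_Cons [of g gs] by (simp add: inverse_circuit_def)
qed (simp add: inverse_circuit_def)

text \<open>Each call becomes a copy of \<open>C\<close> or of its inverse, at equal cost, and the
  other gates stay free.\<close>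

lemma num_queries_expand:
  "num_queries (concat (map (expand_gate C) gs)) = num_queries gs * num_queries C"
proof (induction gs)
  case (Cons g gs)
  have "num_queries (expand_gate C g) = num_queries [g] * num_queries C" by (cases g) auto
  then show ?case using Cons num_queries_Cons [of g gs] by (simp add: algebra_simps)
qed simp

lemma implements_append:
  assumes "implements N U xs X" "implements N U ys Y"
  shows "implements N U (xs @ ys) (X ** Y)"
proof -
  obtain a b where "cmod a = 1" "X = cscale a (circuit_matrix U xs)"
    "cmod b = 1" "Y = cscale b (circuit_matrix U ys)"
    using assms by (auto simp: implements_def)
  then have "cmod (a * b) = 1 \<and> X ** Y = cscale (a * b) (circuit_matrix U (xs @ ys))"
    by (simp add: norm_mult circuit_matrix_append cscale_mult_left cscale_mult_right mult.commute)
  then show ?thesis using assms by (auto simp: implements_def)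
qed

lemma implements_inverse:
  assumes N: "non_query_gates ket0 N" and X: "implements N U gs X"
  shows "implements N U (inverse_circuit gs) (dagger X)"
proof -
  obtain a where "cmod a = 1" "X = cscale a (circuit_matrix U gs)"
    using X by (auto simp: implements_def)
  then have "cmod (cnj a) = 1 \<and> dagger X = cscale (cnj a) (circuit_matrix U (inverse_circuit gs))"
    by (simp add: dagger_cscale circuit_matrix_inverse)
  moreover have "A \<in> N" if "Non_Query A \<in> set (inverse_circuit gs)" for A
  proof -
    obtain g where g: "g \<in> set gs" "Non_Query A = inverse_gate g"
      using \<open>Non_Query A \<in> set (inverse_circuit gs)\<close> by (auto simp: inverse_circuit_def)
    obtain B where "g = Non_Query B" "A = dagger B" using g(2) by (cases g) auto
    then show ?thesis using g N X by (auto simp: implements_def non_query_gates_def)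
  qed
  ultimately show ?thesis unfolding implements_def by blast
qed

section \<open>Substitution of circuits and recursive expansion\<close>

lemma implements_scale: "implements N U gs X \<Longrightarrow> cmod a = 1 \<Longrightarrow> implements N U gs (cscale a X)"
  unfolding implements_def by (metis cscale_cscale mult_1 norm_mult)

text \<open>As \<open>C\<close> realizes \<open>U'\<close> only up to a phase, every substituted
  copy contributes a phase. The induction therefore runs on \<open>implements\<close>, which absorbs
  them, and not on an equality of matrices.\<close>

lemma implements_expand:
  assumes N: "non_query_gates ket0 N" and C: "implements N U C U'"
    and X: "implements N U' gs X"
  shows "implements N U (concat (map (expand_gate C) gs)) X"
proof -
  have "\<forall>A. Non_Query A \<in> set gs \<longrightarrow> A \<in> N \<Longrightarrow>
      implements N U (concat (map (expand_gate C) gs)) (circuit_matrix U' gs)"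
  proof (induction gs)
    case Nil
    then show ?case by (auto simp: implements_def intro!: exI [of _ 1])
  next
    case (Cons g gs)
    have "implements N U (expand_gate C g) (gate_matrix U' g)"
    proof (cases g)
      case (Non_Query A)
      with Cons.prems show ?thesis by (auto simp: implements_def intro!: exI [of _ 1])
    qed (use C implements_inverse [OF N C] in auto)
    then show ?case using Cons by (auto intro: implements_append)
  qed
  then show ?thesis using X implements_scale by (auto simp: implements_def [of N U'])
qed

lemma implements_expansion:
  assumes "non_query_gates ket0 N"
    and "\<And>k. k < n \<Longrightarrow> implements N (U k) (W k) (V k)"
    and "\<And>k. k < n \<Longrightarrow> U (Suc k) = V k ** U k"
  shows "implements N (U 0) (expansion W n) (U n)"
  using assms(2,3)
proof (induction n)
  case 0
  show ?case by (auto simp: implements_def intro!: exI [of _ 1])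
next
  case (Suc n)
  then have "implements N (U 0) (expansion W n) (U n)" "implements N (U n) (W n) (V n)"
    by auto
  then show ?case
    using Suc.prems(2) [of n] by (auto intro: implements_append implements_expand [OF assms(1)])
qed

text \<open>One level consists of at most \<open>b\<close> substituted copies of the previous
  circuit and one trailing copy, whence the factor \<open>1 + b\<close>; the initial circuit is a
  single call.\<close>

lemma num_queries_expansion:
  assumes "\<And>k. k < n \<Longrightarrow> num_queries (W k) \<le> b"
  shows "num_queries (expansion W n) \<le> (1 + b) ^ n"
  using assms
proof (induction n)
  case (Suc n)
  have "num_queries (expansion W (Suc n)) = (1 + num_queries (W n)) * num_queries (expansion W n)"
    by (simp add: num_queries_expand)
  also have "\<dots> \<le> (1 + b) * (1 + b) ^ n"
    using Suc by (intro mult_mono) auto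
  finally show ?case by simp
qed simp

lemma implementable_within_mult:
  "implementable_within N U X a \<Longrightarrow> implementable_within N U Y b \<Longrightarrow>
    implementable_within N U (X ** Y) (a + b)"
  unfolding implementable_within_def
  by (metis add_mono implements_append num_queries_append)

section \<open>Exponentials of projections\<close>

text \<open>All positive powers of \<open>cscale c P\<close> are multiples of \<open>P\<close>, so
  the scalar exponential series acts on \<open>P\<close> and the identity is left over.\<close>

lemma mat_exp_projection:
  fixes P :: "'n::finite cmat"
  assumes "P ** P = P"
  shows "mat_exp (cscale c P) = mat 1 + cscale (exp c - 1) P"
proof -
  have pow: "(((**) (cscale c P)) ^^ k) (mat 1) = (if k = 0 then mat 1 else cscale (c ^ k) P)" for k
  proof (induction k)
    case (Suc k)
    then show ?case
      by (cases k) (auto simp: cscale_mult_left cscale_mult_right assms mult.commute)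
  qed simp
  have lin: "bounded_linear (\<lambda>z. cscale z P)"
  proof -
    have "linear (\<lambda>z. cscale z P)"
      by (auto intro!: linearI simp: cscale_def vec_eq_iff algebra_simps)
    then show ?thesis by (simp add: linear_conv_bounded_linear)
  qed
  have "(\<lambda>k. cscale (c ^ k /\<^sub>R fact k) P) sums cscale (exp c) P"
    by (rule bounded_linear.sums [OF lin exp_converges])
  \<comment> \<open>The scalar series applied to \<open>P\<close> starts with \<open>P\<close>, the
    matrix series with \<open>mat 1\<close>; this one-term series makes up the difference.\<close>
  moreover have "(\<lambda>k. if k = 0 then mat 1 - P else 0) sums (mat 1 - P)"
    using sums_single [of 0 "\<lambda>_. mat 1 - P"] by simp
  ultimately have "(\<lambda>k. (if k = 0 then mat 1 - P else 0) + cscale (c ^ k /\<^sub>R fact k) P)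
      sums (mat 1 - P + cscale (exp c) P)"
    by (intro sums_add)
  also have "(\<lambda>k. (if k = 0 then mat 1 - P else 0) + cscale (c ^ k /\<^sub>R fact k) P)
      = (\<lambda>k. (1 / fact k) *\<^sub>R (((**) (cscale c P)) ^^ k) (mat 1))"
    by (simp add: pow fun_eq_iff) (simp add: cscale_def vec_eq_iff scaleR_conv_of_real [where 'a = complex] field_simps)
  also have "mat 1 - P + cscale (exp c) P = mat 1 + cscale (exp c - 1) P"
    by (simp add: cscale_def vec_eq_iff algebra_simps)
  finally show ?thesis unfolding mat_exp_def by (rule sums_unique [symmetric])
qed

lemma mat_exp_ketbra_conj:
  assumes "unitary U" "cinner x x = 1"
  shows "mat_exp (cscale c (ketbra (U *v x))) = U ** mat_exp (cscale c (ketbra x)) ** dagger U"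
proof -
  have "cinner (U *v x) (U *v x) = 1" using assms by (simp add: cinner_self unitary_norm)
  then show ?thesis
    using assms
    by (simp add: mat_exp_projection ketbra_idem matrix_add_ldistrib matrix_add_rdistrib unitary_def
        cscale_mult_left cscale_mult_right mult_ketbra)
qed

text \<open>The phase gate about \<open>U *v ket0\<close> is the one about \<open>ket0\<close>
  conjugated by \<open>U\<close>: one call to \<open>U\<close>, one to its inverse.\<close>

lemma implementable_exp_ketbra:
  assumes N: "non_query_gates ket0 N" and ket0: "cinner ket0 ket0 = 1" and U: "unitary U"
  shows "implementable_within N U (mat_exp (cscale (\<i> * of_real \<theta>) (ketbra (U *v ket0)))) 2"
proof -
  let ?E = "mat_exp (cscale (\<i> * of_real \<theta>) (ketbra ket0))"
  have "?E \<in> N" using N by (simp add: non_query_gates_def)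
  then have "implements N U [Query, Non_Query ?E, Query_Inv] (U ** ?E ** dagger U)"
    by (auto simp: implements_def matrix_mul_assoc intro!: exI [of _ 1])
  then show ?thesis
    unfolding implementable_within_def mat_exp_ketbra_conj [OF U ket0]
    by (auto intro!: exI [of _ "[Query, Non_Query ?E, Query_Inv]"] simp: num_queries_def)
qed

text \<open>The coefficient of the projection is \<open>exp (\<i> * pi) - 1 = -2\<close>; thus the
  reflection inherits the two-call cost of a phase gate.\<close>

lemma reflection_eq_mat_exp:
  assumes "cinner x x = 1"
  shows "mat 1 - 2 *\<^sub>R ketbra x = mat_exp (cscale (\<i> * of_real pi) (ketbra x))"
proof -
  have "exp (\<i> * of_real pi) = -1" by (simp add: exp_pi_i')
  then show ?thesis
    using assms by (simp add: mat_exp_projection ketbra_idem)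
      (simp add: cscale_def vec_eq_iff scaleR_conv_of_real [where 'a = complex])
qed

section \<open>Call counts of the two product formulas\<close>

lemma implementable_V_Gen:
  assumes N: "non_query_gates ket0 N" and ket0: "cinner ket0 ket0 = 1" and U: "unitary U"
    and A: "\<And>\<theta>. \<theta> \<in> {sqrt (\<tau> / 2), - sqrt (\<tau> / 2)} \<Longrightarrow>
      implementable_within N U (A (ketbra (U *v ket0)) \<theta>) a"
  shows "implementable_within N U (V_Gen A (ketbra (U *v ket0)) \<tau>) (8 + 4 * a)"
proof -
  \<comment> \<open>The summands follow the order and left association of the eight factors, so the
    product rule applies factor by factor.\<close>
  have "8 + 4 * a = a + 2 + a + 2 + a + 2 + a + 2" by simp
  then show ?thesis
    unfolding V_Gen_def Let_def
    by (simp only:) (intro implementable_within_mult A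
        implementable_exp_ketbra [OF N ket0 U] insertI1 insertI2)
qed

lemma implementable_V_NLSE:
  assumes N: "non_query_gates ket0 N" and ket0: "cinner ket0 ket0 = 1" and U: "unitary U"
    and A: "\<And>\<theta>. \<theta> \<in> {\<tau> / 2, - (\<tau> / 2)} \<Longrightarrow>
      implementable_within N U (A (ketbra (U *v ket0)) \<theta>) a"
  shows "implementable_within N U (V_NLSE A (ketbra (U *v ket0)) \<tau>) (4 + 2 * a)"
proof -
  have "4 + 2 * a = a + 2 + a + 2" by simp
  moreover have "cinner (U *v ket0) (U *v ket0) = 1"
    using ket0 U by (simp add: cinner_self unitary_norm)
  ultimately show ?thesis
    unfolding V_NLSE_def Let_def
    by (simp only: reflection_eq_mat_exp) (intro implementable_within_mult A
        implementable_exp_ketbra [OF N ket0 U] insertI1 insertI2)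
qed

section \<open>Global error and query count of the iteration\<close>

theorem theorem6:
  fixes ket0 \<psi>0 :: "complex ^ 'n::finite"
    and N :: "'n cmat set"
    and G :: "'n cmat \<Rightarrow> 'n cmat" and M_G L_G :: real
    and \<phi> :: "real \<Rightarrow> 'n cmat \<Rightarrow> 'n cmat"
    and T \<epsilon> lam C_step \<tau> :: real and \<Lambda> :: "real \<Rightarrow> real" and M :: nat
    and V :: "'n cmat \<Rightarrow> real \<Rightarrow> 'n cmat"
    and \<rho> U :: "nat \<Rightarrow> 'n cmat"
    and \<Omega> :: "'n cmat set"
  assumes ket0: "cinner ket0 ket0 = 1"
    and gates: "non_query_gates ket0 N"
    and G: "bounded_lipschitz_generator G M_G L_G"
    and flow: "double_bracket_flow G \<phi>"
    and pos: "T > 0" "\<epsilon> > 0" "C_step > 0"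
    and regime:
      "(lam > 0 \<and> (\<forall>t\<ge>0. \<Lambda> t = exp (- lam * t)) \<and>
          int M = \<lceil>Max {1, T, lam * T, 2 * C_step * T / (lam * \<epsilon>)}\<rceil>) \<or>
       ((\<forall>t\<ge>0. \<Lambda> t = 1) \<and>
          int M = \<lceil>Max {1, T, C_step * T\<^sup>2 / \<epsilon>}\<rceil>) \<or>
       (lam > 0 \<and> (\<forall>t\<ge>0. \<Lambda> t = exp (lam * t)) \<and>
          int M = \<lceil>Max {1, T, lam * T, C_step * T * exp (lam * T) / (lam * \<epsilon>)}\<rceil>)"
    and tau: "\<tau> = T / real M"
    and V: "\<And>\<sigma> h. \<sigma> \<in> pure_states \<Longrightarrow> 0 < h \<Longrightarrow> h \<le> 1 \<Longrightarrow> unitary (V \<sigma> h)"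
    and init: "unitary (U 0)" "U 0 *v ket0 = \<psi>0" "\<rho> 0 = ketbra \<psi>0"
    and iter: "\<And>k. k < M \<Longrightarrow> \<rho> (Suc k) = implemented_step V \<tau> (\<rho> k)"
              "\<And>k. k < M \<Longrightarrow> U (Suc k) = V (\<rho> k) \<tau> ** U k"
    and Omega: "\<Omega> \<subseteq> pure_states"
    and i: "{\<phi> t (\<rho> 0) | t. 0 \<le> t \<and> t \<le> T} \<union> {\<rho> k | k. k \<le> M} \<subseteq> \<Omega>"
    and ii: "\<And>\<sigma>1 \<sigma>2 t. \<sigma>1 \<in> \<Omega> \<Longrightarrow> \<sigma>2 \<in> \<Omega> \<Longrightarrow> 0 \<le> t \<Longrightarrow>
               trace_norm (\<phi> t \<sigma>1 - \<phi> t \<sigma>2) \<le> \<Lambda> t * trace_norm (\<sigma>1 - \<sigma>2)"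
    and iii: "\<And>\<sigma> h. \<sigma> \<in> \<Omega> \<Longrightarrow> 0 < h \<Longrightarrow> h \<le> 1 \<Longrightarrow>
               trace_norm (implemented_step V h \<sigma> - \<phi> h \<sigma>) \<le> C_step * h\<^sup>2"
  shows
    "(\<forall>b. (\<forall>k<M. implementable_within N (U k) (V (\<rho> k) \<tau>) b) \<longrightarrow>
        \<rho> M = ketbra (U M *v ket0) \<and>
        trace_norm (\<rho> M - \<phi> T (\<rho> 0)) \<le> \<epsilon> \<and>
        (\<forall>W. (\<forall>k<M. implements N (U k) (W k) (V (\<rho> k) \<tau>) \<and> num_queries (W k) \<le> b) \<longrightarrow>
           implements N (U 0) (expansion W M) (U M) \<and>
           num_queries (expansion W M) \<le> (1 + b) ^ M) \<and>
        real ((1 + b) ^ M) = exp (real M * ln (1 + real b))) \<and>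
     (\<forall>A_G c_G a_G. Gen_subroutine G c_G A_G \<longrightarrow>
        (\<forall>\<sigma>\<in>pure_states. \<forall>h. 0 < h \<and> h \<le> 1 \<longrightarrow> V \<sigma> h = V_Gen A_G \<sigma> h) \<longrightarrow>
        (\<forall>k<M. \<forall>\<theta>\<in>{sqrt (\<tau> / 2), - sqrt (\<tau> / 2)}.
           implementable_within N (U k) (A_G (\<rho> k) \<theta>) a_G) \<longrightarrow>
        (\<forall>k<M. implementable_within N (U k) (V (\<rho> k) \<tau>) (8 + 4 * a_G))) \<and>
     (\<forall>H M_H L_H A_H c_H a_H. bounded_lipschitz_generator H M_H L_H \<longrightarrow>
        (\<forall>\<sigma>\<in>pure_states. G \<sigma> = cscale (- \<i>) (commutator \<sigma> (H \<sigma>))) \<longrightarrow>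
        NLSE_subroutine H c_H A_H \<longrightarrow>
        (\<forall>\<sigma>\<in>pure_states. \<forall>h. 0 < h \<and> h \<le> 1 \<longrightarrow> V \<sigma> h = V_NLSE A_H \<sigma> h) \<longrightarrow>
        (\<forall>k<M. \<forall>\<theta>\<in>{\<tau> / 2, - (\<tau> / 2)}.
           implementable_within N (U k) (A_H (\<rho> k) \<theta>) a_H) \<longrightarrow>
        (\<forall>k<M. implementable_within N (U k) (V (\<rho> k) \<tau>) (4 + 2 * a_H)))"
proof -
  note steps = step_number_bound [OF pos regime tau]
  \<comment> \<open>Both facts are carried together: unitarity of the next step is available because
    \<open>\<rho> k\<close> is pure, which rests on unitarity of \<open>U k\<close>.\<close>
  have state: "\<rho> k = ketbra (U k *v ket0) \<and> unitary (U k)" if "k \<le> M" for k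
    using that
  proof (induction k)
    case 0
    then show ?case using init by simp
  next
    case (Suc k)
    then have k: "k < M" and IH: "\<rho> k = ketbra (U k *v ket0)" "unitary (U k)" by auto
    have "unitary (V (\<rho> k) \<tau>)"
      using V steps pure_states_unitary [OF IH(2) ket0] by (simp add: IH(1))
    then show ?case
      using k IH by (simp add: iter implemented_step_def mult_ketbra matrix_vector_mul_assoc unitary_mult)
  qed
  then have pure: "\<rho> k \<in> pure_states" if "k \<le> M" for k
    using that ket0 pure_states_unitary by metis
  have flow_pure: "\<phi> t \<sigma> \<in> pure_states" if "\<sigma> \<in> pure_states" "t \<ge> 0" for t \<sigma>
    using flow that by (auto simp: double_bracket_flow_def)
  have error: "trace_norm (\<rho> M - \<phi> T (\<rho> 0)) \<le> \<epsilon>"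
  proof -
    \<comment> \<open>The distance to the exact trajectory at the grid time
      \<open>k * \<tau>\<close>; the last grid time is \<open>T\<close>.\<close>
    define e where "e k = trace_norm (\<rho> k - \<phi> (real k * \<tau>) (\<rho> 0))" for k
    have "e M \<le> C_step * \<tau>\<^sup>2 * (\<Sum>j<M. \<Lambda> \<tau> ^ j)"
    proof (rule affine_recursion_bound)
      have "\<phi> 0 (\<rho> 0) = \<rho> 0" using flow pure by (simp add: double_bracket_flow_def)
      then show "e 0 = 0"
        using trace_norm_pure_diff [OF pure [of 0] pure [of 0]] by (simp add: e_def)
    next
      fix k assume k: "k < M"
      let ?\<sigma> = "\<phi> (real k * \<tau>) (\<rho> 0)"
      have t: "0 \<le> real k * \<tau>" using steps by simp
      have "real k * \<tau> \<le> real M * \<tau>" using k steps by (intro mult_right_mono) auto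
      also have "\<dots> = T" using steps by (simp add: tau)
      finally have \<Omega>: "\<rho> k \<in> \<Omega>" "?\<sigma> \<in> \<Omega>"
        using i k t by (auto intro: less_imp_le)
      have p: "\<rho> (Suc k) \<in> pure_states" "\<phi> \<tau> (\<rho> k) \<in> pure_states" "\<phi> \<tau> ?\<sigma> \<in> pure_states"
        using k pure flow_pure steps t by auto
      \<comment> \<open>The semigroup law turns the next point of the trajectory into one exact step
        from \<open>?\<sigma>\<close>, so that stability can be applied.\<close>
      have "\<phi> \<tau> ?\<sigma> = \<phi> (real (Suc k) * \<tau>) (\<rho> 0)"
        using double_bracket_flow_semigroup [OF G flow pure [of 0], of \<tau>] steps t
        by (simp add: algebra_simps)
      then have "e (Suc k) = trace_norm (\<rho> (Suc k) - \<phi> \<tau> ?\<sigma>)"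
        by (simp only: e_def)
      \<comment> \<open>The intermediate point is one exact step from \<open>\<rho> k\<close>. All
        states involved are pure, so the triangle inequality is that of the Frobenius norm.\<close>
      also have "\<dots> \<le> trace_norm (\<rho> (Suc k) - \<phi> \<tau> (\<rho> k)) + trace_norm (\<phi> \<tau> (\<rho> k) - \<phi> \<tau> ?\<sigma>)"
        using p norm_triangle_ineq [of "\<rho> (Suc k) - \<phi> \<tau> (\<rho> k)" "\<phi> \<tau> (\<rho> k) - \<phi> \<tau> ?\<sigma>"]
        by (simp add: trace_norm_pure_diff flip: distrib_left)
      \<comment> \<open>The local error is taken at \<open>\<rho> k\<close>, the stability estimate
        between \<open>\<rho> k\<close> and \<open>?\<sigma>\<close>, both in
        \<open>\<Omega>\<close>.\<close>
      also have "\<dots> \<le> C_step * \<tau>\<^sup>2 + \<Lambda> \<tau> * e k"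
        using iii [OF \<Omega>(1), of \<tau>] ii [OF \<Omega>, of \<tau>] steps k by (simp add: iter e_def)
      finally show "e (Suc k) \<le> C_step * \<tau>\<^sup>2 + \<Lambda> \<tau> * e k" .
    qed (rule steps)
    also have "\<dots> \<le> \<epsilon>" by (rule steps)
    finally show ?thesis using steps by (simp add: e_def tau)
  qed
  have V_eq: "V (\<rho> k) \<tau> = X (ketbra (U k *v ket0)) \<tau>"
    if "\<forall>\<sigma>\<in>pure_states. \<forall>h. 0 < h \<and> h \<le> 1 \<longrightarrow> V \<sigma> h = X \<sigma> h" "k < M" for X k
    using that pure [of k] state [of k] steps by auto
  have log_form: "real ((1 + b) ^ M) = exp (real M * ln (1 + real b))" for b
    by (simp add: exp_of_nat_mult)
  have gen: "implementable_within N (U k) (V (\<rho> k) \<tau>) (8 + 4 * a)"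
    if "\<forall>\<sigma>\<in>pure_states. \<forall>h. 0 < h \<and> h \<le> 1 \<longrightarrow> V \<sigma> h = V_Gen A \<sigma> h" "k < M"
      "\<forall>k<M. \<forall>\<theta>\<in>{sqrt (\<tau> / 2), - sqrt (\<tau> / 2)}. implementable_within N (U k) (A (\<rho> k) \<theta>) a"
    for A a k
    unfolding V_eq [OF that(1,2)]
    by (rule implementable_V_Gen [OF gates ket0]) (use that state [of k] in auto)
  have nlse: "implementable_within N (U k) (V (\<rho> k) \<tau>) (4 + 2 * a)"
    if "\<forall>\<sigma>\<in>pure_states. \<forall>h. 0 < h \<and> h \<le> 1 \<longrightarrow> V \<sigma> h = V_NLSE A \<sigma> h" "k < M"
      "\<forall>k<M. \<forall>\<theta>\<in>{\<tau> / 2, - (\<tau> / 2)}. implementable_within N (U k) (A (\<rho> k) \<theta>) a"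
    for A a k
    unfolding V_eq [OF that(1,2)]
    by (rule implementable_V_NLSE [OF gates ket0]) (use that state [of k] in auto)
  show ?thesis
  proof (intro conjI allI impI)
    show "\<rho> M = ketbra (U M *v ket0)" using state by simp
    show "implements N (U 0) (expansion W M) (U M)"
      if "\<forall>k<M. implements N (U k) (W k) (V (\<rho> k) \<tau>) \<and> num_queries (W k) \<le> b" for W b
      using that implements_expansion [OF gates, of M U W "\<lambda>k. V (\<rho> k) \<tau>"] iter by auto
    show "num_queries (expansion W M) \<le> (1 + b) ^ M"
      if "\<forall>k<M. implements N (U k) (W k) (V (\<rho> k) \<tau>) \<and> num_queries (W k) \<le> b" for W b
      using that num_queries_expansion [of M W b] by auto
  qed (rule error log_form | rule gen nlse; assumption)+
qed

end
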